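(* Let $S=(S_t)_{t\ge0}$ be a subordinator with zero drift whose Laplace exponent $\phi$ satisfies (L) with $\lambda_L=0$, and let $X=(X_t)_{t\ge0}$ be the corresponding subordinate Brownian motion in $\mathbb{R}^d$ ($d\ge1$). Assume that $X$ is transient and that, in the case $d\le2$, $\phi$ additionally satisfies (U) with $\delta<d/2$ and $\lambda_U=0$. Then the Green function $G$ of $X$ satisfies $$G(x)\asymp\frac{1}{|x|^d\phi(|x|^{-2})},\qquad x\in\mathbb{R}^d,\ x\ne0.$$
   Context: A subordinator $S=(S_t)_{t\ge0}$ is an increasing Lévy process with values in $[0,\infty)$, started at $0$. Its Laplace exponent $\phi$ is defined by $\mathbb{E}e^{-\lambda S_t}=e^{-t\phi(\lambda)}$, $\lambda>0$, and $\phi(\lambda)=b\lambda+\int_{(0,\infty)}(1-e^{-\lambda s})\mu(ds)$, where $b\ge0$ is the drift and $\mu$ is the Lévy measure, a measure on $(0,\infty)$ with $\int_{(0,\infty)}(1\wedge s)\mu(ds)<\infty$. The corresponding subordinate Brownian motion is $X_t=B_{S_t}$, where $B$ is a Brownian motion in $\mathbb{R}^d$ independent of $S$, normalized so that $\mathbb{E}e^{i\xi\cdot B_t}=e^{-t|\xi|^2}$; its transition density is $p(t,x,y)=p(t,y-x)$ with $p(t,x)=\int_{(0,\infty)}(4\pi s)^{-d/2}e^{-|x|^2/(4s)}\,\mathbb{P}(S_t\in ds)$. $X$ is transient if $\mathbb{P}_0(\lim_{t\to\infty}|X_t|=\infty)=1$, where $\mathbb{P}_0$ is the law of $X$ started at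 $0$; in that case the Green function is $G(x)=\int_0^\infty p(t,x)\,dt$, $x\ne0$. Scaling conditions for $f:(0,\infty)\to(0,\infty)$. (L): there exist $\gamma>0$, $\lambda_L\ge0$, $C_L>0$ such that $f(\lambda x)/f(\lambda)\ge C_Lx^\gamma$ for all $\lambda>\lambda_L$, $x\ge1$. (U): there exist $\delta>0$, $\lambda_U\ge0$, $C_U>0$ such that $f(\lambda x)/f(\lambda)\le C_Ux^\delta$ for all $\lambda>\lambda_U$, $x\ge1$. $f\asymp g$ on a set means there are constants $c_1,c_2>0$ with $c_1f\le g\le c_2f$ on that set. *)

theory Defs
  imports "HOL-Probability.Probability"
begin

text \<open>
  A process is a family \<open>X :: real \<Rightarrow> 'w \<Rightarrow> 'a\<close> of random variables on a probability space, of which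
  only the times \<open>t \<ge> 0\<close> matter. Path properties and the initial value are required almost surely.
\<close>

definition cadlag :: "(real \<Rightarrow> 'a::topological_space) \<Rightarrow> bool" where
  "cadlag f \<longleftrightarrow>
     (\<forall>t\<ge>0. continuous (at_right t) f) \<and> (\<forall>t>0. \<exists>l. (f \<longlongrightarrow> l) (at_left t))"

definition levy_process :: "'w measure \<Rightarrow> (real \<Rightarrow> 'w \<Rightarrow> 'a::euclidean_space) \<Rightarrow> bool" where
  "levy_process M X \<longleftrightarrow>
     prob_space M \<and>
     (\<forall>t\<ge>0. X t \<in> borel_measurable M) \<and>
     (AE \<omega> in M. X 0 \<omega> = 0) \<and>
     (\<forall>(n::nat) (t::nat \<Rightarrow> real). 0 \<le> t 0 \<longrightarrow> (\<forall>i<n. t i < t (Suc i)) \<longrightarrow>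
        prob_space.indep_vars M (\<lambda>_. borel) (\<lambda>i \<omega>. X (t (Suc i)) \<omega> - X (t i) \<omega>) {..<n}) \<and>
     (\<forall>s\<ge>0. \<forall>t\<ge>0. distr M borel (\<lambda>\<omega>. X (s + t) \<omega> - X s \<omega>) = distr M borel (X t)) \<and>
     (AE \<omega> in M. cadlag (\<lambda>t. X t \<omega>))"

definition subordinator :: "'w measure \<Rightarrow> (real \<Rightarrow> 'w \<Rightarrow> real) \<Rightarrow> bool" where
  "subordinator M S \<longleftrightarrow>
     levy_process M S \<and>
     (AE \<omega> in M. (\<forall>t\<ge>0. 0 \<le> S t \<omega>) \<and> mono_on {0..} (\<lambda>t. S t \<omega>))"

definition laplace_exponent ::
  "'w measure \<Rightarrow> (real \<Rightarrow> 'w \<Rightarrow> real) \<Rightarrow> (real \<Rightarrow> real) \<Rightarrow> bool" where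
  "laplace_exponent M S \<phi> \<longleftrightarrow>
     (\<forall>t\<ge>0. \<forall>r>0. (LINT \<omega>|M. exp (- r * S t \<omega>)) = exp (- t * \<phi> r))"

definition levy_measure :: "real measure \<Rightarrow> bool" where
  "levy_measure \<mu> \<longleftrightarrow>
     sets \<mu> = sets (restrict_space borel {0<..}) \<and> (\<integral>\<^sup>+ s. ennreal (min 1 s) \<partial>\<mu>) < \<infinity>"

definition levy_khintchine :: "(real \<Rightarrow> real) \<Rightarrow> real \<Rightarrow> real measure \<Rightarrow> bool" where
  "levy_khintchine \<phi> b \<mu> \<longleftrightarrow>
     0 \<le> b \<and> levy_measure \<mu> \<and>
     (\<forall>r>0. \<phi> r = b * r + (LINT s|\<mu>. 1 - exp (- r * s)))"

text \<open>
  The normalization of the characteristic function makes the components of \<open>B t\<close> centred Gaussians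
  of variance \<open>2 * t\<close>.
\<close>

definition brownian_motion :: "'w measure \<Rightarrow> (real \<Rightarrow> 'w \<Rightarrow> 'a::euclidean_space) \<Rightarrow> bool" where
  "brownian_motion M B \<longleftrightarrow>
     levy_process M B \<and>
     (AE \<omega> in M. continuous_on {0..} (\<lambda>t. B t \<omega>)) \<and>
     (\<forall>t\<ge>0. \<forall>\<xi>. (LINT \<omega>|M. exp (\<i> * complex_of_real (\<xi> \<bullet> B t \<omega>)))
                    = complex_of_real (exp (- t * (norm \<xi>)\<^sup>2)))"

definition process_sigma ::
  "'w measure \<Rightarrow> (real \<Rightarrow> 'w \<Rightarrow> 'a::topological_space) \<Rightarrow> 'w set set" where
  "process_sigma M X =
     sets (vimage_algebra (space M) (\<lambda>\<omega>. \<lambda>t\<in>{0..}. X t \<omega>) (\<Pi>\<^sub>M t\<in>{0..}. borel))"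

text \<open>The library's \<open>indep_var\<close> would force both processes to have the same value type.\<close>

definition independent_processes ::
  "'w measure \<Rightarrow> (real \<Rightarrow> 'w \<Rightarrow> 'a::topological_space) \<Rightarrow>
     (real \<Rightarrow> 'w \<Rightarrow> 'b::topological_space) \<Rightarrow> bool" where
  "independent_processes M X Y \<longleftrightarrow>
     prob_space.indep_set M (process_sigma M X) (process_sigma M Y)"

definition subordinate :: "(real \<Rightarrow> 'w \<Rightarrow> 'a) \<Rightarrow> (real \<Rightarrow> 'w \<Rightarrow> real) \<Rightarrow> real \<Rightarrow> 'w \<Rightarrow> 'a" where
  "subordinate B S t \<omega> = B (S t \<omega>) \<omega>"

definition transient :: "'w measure \<Rightarrow> (real \<Rightarrow> 'w \<Rightarrow> 'a::real_normed_vector) \<Rightarrow> bool" where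
  "transient M X \<longleftrightarrow> (AE \<omega> in M. filterlim (\<lambda>t. norm (X t \<omega>)) at_top at_top)"

text \<open>
  The transition density and the Green function of the subordinate Brownian motion depend only on
  the laws of the \<open>S t\<close> and on the dimension. They take values in \<^typ>\<open>ennreal\<close>, so that finiteness
  is not presupposed.
\<close>

definition transition_density ::
  "'w measure \<Rightarrow> (real \<Rightarrow> 'w \<Rightarrow> real) \<Rightarrow> real \<Rightarrow> 'a::euclidean_space \<Rightarrow> ennreal" where
  "transition_density M S t x =
     (\<integral>\<^sup>+ s \<in> {0<..}.
        ennreal ((4 * pi * s) powr (- (real DIM('a) / 2)) * exp (- (norm x)\<^sup>2 / (4 * s)))
        \<partial>(distr M borel (S t)))"

definition green_function ::
  "'w measure \<Rightarrow> (real \<Rightarrow> 'w \<Rightarrow> real) \<Rightarrow> 'a::euclidean_space \<Rightarrow> ennreal" where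
  "green_function M S x = (\<integral>\<^sup>+ t \<in> {0..}. transition_density M S t x \<partial>lborel)"

definition lower_scaling :: "(real \<Rightarrow> real) \<Rightarrow> real \<Rightarrow> real \<Rightarrow> real \<Rightarrow> bool" where
  "lower_scaling f \<gamma> rL CL \<longleftrightarrow>
     (\<forall>x>0. 0 < f x) \<and> 0 < \<gamma> \<and> 0 \<le> rL \<and> 0 < CL \<and>
     (\<forall>r>rL. \<forall>x\<ge>1. f (r * x) / f r \<ge> CL * x powr \<gamma>)"

definition upper_scaling :: "(real \<Rightarrow> real) \<Rightarrow> real \<Rightarrow> real \<Rightarrow> real \<Rightarrow> bool" where
  "upper_scaling f \<delta> rU CU \<longleftrightarrow>
     (\<forall>x>0. 0 < f x) \<and> 0 < \<delta> \<and> 0 \<le> rU \<and> 0 < CU \<and>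
     (\<forall>r>rU. \<forall>x\<ge>1. f (r * x) / f r \<le> CU * x powr \<delta>)"

definition comparable_on :: "'a set \<Rightarrow> ('a \<Rightarrow> ennreal) \<Rightarrow> ('a \<Rightarrow> ennreal) \<Rightarrow> bool" where
  "comparable_on A f g \<longleftrightarrow>
     (\<exists>c1 c2 :: real. 0 < c1 \<and> 0 < c2 \<and>
        (\<forall>x\<in>A. ennreal c1 * f x \<le> g x \<and> g x \<le> ennreal c2 * f x))"

end

theory Submission
  imports Defs
begin

text \<open>
  The Green function integrates the Gaussian kernel against the potential measure \<open>U\<close> of the
  subordinator, whose Laplace transform is \<open>1 / \<phi>\<close>. With \<open>R = |x|\<^sup>2\<close>, \<open>u = s / R\<close> and \<open>h = d / 2\<close>,
  the profile \<open>K u = u powr (- h) * exp (- 1 / (4 * u))\<close> is compared with exponentials pointwise: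
  \<open>K u\<close> is at most a constant times the sum over \<open>k\<close> of \<open>2 powr (- k * h) * exp (- u / 2 ^ k)\<close>,
  and \<open>exp (- u)\<close> is at most a multiple of \<open>K u\<close> plus \<open>exp (1 - u / a)\<close> (which handles \<open>u < a\<close>) plus
  \<open>exp (- b / 2) * exp (- u / 2)\<close> (which handles \<open>u > b\<close>). Integrating against \<open>U\<close> turns every
  exponential into a value of \<open>1 / \<phi>\<close>. Upper scaling with \<open>\<delta> < h\<close> makes the series converge; lower
  and upper scaling make the two error terms small for small \<open>a\<close> and large \<open>b\<close>.
\<close>

section \<open>The potential measure and its Laplace transform\<close>

text \<open>Encoded as a bind, so that \<open>nn_integral_bind\<close> unfolds integrals against it;
  only the kernel has to be subprobability-valued, the measure on the times may be infinite.\<close>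

definition potential_measure :: "'w measure \<Rightarrow> (real \<Rightarrow> 'w \<Rightarrow> real) \<Rightarrow> real measure" where
  "potential_measure M S = restrict_space lborel {0..} \<bind> (\<lambda>t. distr M borel (S t))"

text \<open>Paths are only almost surely regular, so measurability in \<open>t\<close> is not inherited from joint
  measurability; it follows from the monotonicity of \<open>t \<mapsto> P (S t \<le> x)\<close>.\<close>

lemma measurable_subordinator_law:
  assumes "subordinator M S"
  shows "(\<lambda>t. distr M borel (S t)) \<in> restrict_space lborel {0..} \<rightarrow>\<^sub>M subprob_algebra borel"
proof (rule measurable_subprob_algebra_generated)
  interpret prob_space M
    using assms by (simp add: subordinator_def levy_process_def)
  have meas[measurable]: "S t \<in> borel_measurable M" if "0 \<le> t" for t
    using assms that by (auto simp: subordinator_def levy_process_def)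
  have law: "prob_space (distr M borel (S t))" if "0 \<le> t" for t
    using that by (intro prob_space_distr) simp
  show "sets borel = sigma_sets UNIV (range (atMost :: real \<Rightarrow> _))"
    by (subst borel_eq_atMost) simp
  show "Int_stable (range (atMost :: real \<Rightarrow> _))"
    by (auto simp: Int_stable_def)
  show "subprob_space (distr M borel (S t))" if "t \<in> space (restrict_space lborel {0..})" for t
    using that by (intro prob_space_imp_subprob_space law) (simp add: space_restrict_space)
  show "(\<lambda>t. emeasure (distr M borel (S t)) UNIV) \<in> borel_measurable (restrict_space lborel {0..})"
  proof (subst measurable_cong)
    show "emeasure (distr M borel (S t)) UNIV = 1"
      if "t \<in> space (restrict_space lborel {0..})" for t
      using prob_space.emeasure_space_1[OF law, of t] that by (simp add: space_restrict_space)
  qed simp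
  fix A assume "A \<in> range (atMost :: real \<Rightarrow> _)"
  then obtain x where A: "A = {..x}" by auto
  \<comment> \<open>The distribution function at \<open>x\<close> decreases in time; the sign makes
    it increasing and is undone below by a second negation.\<close>
  have mono: "mono_on {0..} (\<lambda>t. - prob {\<omega> \<in> space M. S t \<omega> \<le> x})"
  proof (rule mono_onI)
    fix s t :: real assume st: "s \<in> {0..}" "t \<in> {0..}" "s \<le> t"
    then have [measurable]: "S s \<in> borel_measurable M" "S t \<in> borel_measurable M"
      using meas by auto
    have "prob {\<omega> \<in> space M. S t \<omega> \<le> x} \<le> prob {\<omega> \<in> space M. S s \<omega> \<le> x}"
    proof (rule finite_measure_mono_AE)
      have "AE \<omega> in M. mono_on {0..} (\<lambda>t. S t \<omega>)"
        using assms by (auto simp: subordinator_def)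
      then show "AE \<omega> in M. \<omega> \<in> {\<omega> \<in> space M. S t \<omega> \<le> x} \<longrightarrow> \<omega> \<in> {\<omega> \<in> space M. S s \<omega> \<le> x}"
        by eventually_elim (use st in \<open>auto dest!: mono_onD[of _ _ s t]\<close>)
    qed simp
    then show "- prob {\<omega> \<in> space M. S s \<omega> \<le> x} \<le> - prob {\<omega> \<in> space M. S t \<omega> \<le> x}"
      by simp
  qed
  have "(\<lambda>t. - prob {\<omega> \<in> space M. S t \<omega> \<le> x}) \<in> borel_measurable (restrict_space borel {0..})"
    using borel_measurable_mono_on_fnc[OF mono] .
  then have "(\<lambda>t. ennreal (- (- prob {\<omega> \<in> space M. S t \<omega> \<le> x})))
      \<in> borel_measurable (restrict_space borel {0..})"
    by measurable
  then have *: "(\<lambda>t. ennreal (- (- prob {\<omega> \<in> space M. S t \<omega> \<le> x})))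
      \<in> borel_measurable (restrict_space lborel {0..})"
    by (simp cong: measurable_cong_sets add: sets_restrict_space)
  show "(\<lambda>t. emeasure (distr M borel (S t)) A) \<in> borel_measurable (restrict_space lborel {0..})"
  proof (rule measurable_cong[THEN iffD1, OF _ *])
    fix t assume "t \<in> space (restrict_space lborel {0::real..})"
    then have "S t -` {..x} \<inter> space M = {\<omega> \<in> space M. S t \<omega> \<le> x}" "S t \<in> borel_measurable M"
      by (auto simp: space_restrict_space)
    then show "ennreal (- (- prob {\<omega> \<in> space M. S t \<omega> \<le> x})) = emeasure (distr M borel (S t)) A"
      by (simp add: A emeasure_distr emeasure_eq_measure)
  qed
qed auto

lemma sets_potential_measure [simp, measurable_cong]: "sets (potential_measure M S) = sets borel"
  unfolding potential_measure_def by (rule sets_bind) (auto simp: space_restrict_space)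

lemma nn_integral_potential_measure:
  assumes "subordinator M S" and "f \<in> borel_measurable borel"
  shows "(\<integral>\<^sup>+ s. f s \<partial>potential_measure M S)
    = (\<integral>\<^sup>+ t \<in> {0..}. (\<integral>\<^sup>+ s. f s \<partial>distr M borel (S t)) \<partial>lborel)"
  unfolding potential_measure_def
  by (subst nn_integral_bind[OF assms(2) measurable_subordinator_law[OF assms(1)]])
    (simp add: nn_integral_restrict_space)

lemma nn_integral_exp_Ici:
  assumes "0 < (c::real)"
  shows "(\<integral>\<^sup>+ t \<in> {0..}. ennreal (exp (- t * c)) \<partial>lborel) = ennreal (1 / c)"
proof -
  have "(\<integral>\<^sup>+ t \<in> {0..}. ennreal (exp (- t * c)) \<partial>lborel) = ennreal (0 - (- exp (- 0 * c) / c))"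
  proof (rule nn_integral_FTC_atLeast)
    show "((\<lambda>t. - exp (- t * c) / c) has_real_derivative exp (- t * c)) (at t)" for t
      using assms by (auto intro!: derivative_eq_intros)
    have "filterlim (\<lambda>t. t * c) at_top at_top"
      using assms by (intro filterlim_at_top_mult_tendsto_pos[OF tendsto_const] filterlim_ident)
    then have "((\<lambda>t. exp (- (t * c))) \<longlongrightarrow> 0) at_top"
      by (intro filterlim_compose[OF exp_at_bot] filterlim_compose[OF filterlim_uminus_at_bot_at_top])
    from tendsto_mult[OF this tendsto_const[of "- 1 / c"]]
    show "((\<lambda>t. - exp (- t * c) / c) \<longlongrightarrow> 0) at_top"
      by simp
  qed auto
  then show ?thesis by simp
qed

text \<open>By Tonelli the left side is the integral of \<open>exp (- t * \<phi> r)\<close> over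
  \<open>t \<ge> 0\<close>.\<close>

lemma laplace_potential_measure:
  assumes S: "subordinator M S" and "laplace_exponent M S \<phi>"
    and r: "0 < r" and \<phi>: "0 < \<phi> r"
  shows "(\<integral>\<^sup>+ s. ennreal (exp (- r * s)) \<partial>potential_measure M S) = ennreal (1 / \<phi> r)"
proof -
  have "(\<integral>\<^sup>+ s. ennreal (exp (- r * s)) \<partial>distr M borel (S t)) = ennreal (exp (- t * \<phi> r))"
    if t: "0 \<le> t" for t
  proof -
    have [measurable]: "S t \<in> borel_measurable M"
      using S t by (auto simp: subordinator_def levy_process_def)
    have eq: "(LINT \<omega>|M. exp (- r * S t \<omega>)) = exp (- t * \<phi> r)"
      using assms(2) t r by (auto simp: laplace_exponent_def)
    \<comment> \<open>A function that is not integrable has integral \<open>0\<close> by convention,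
      whereas \<open>exp (- t * \<phi> r)\<close> is positive.\<close>
    then have "integrable M (\<lambda>\<omega>. exp (- r * S t \<omega>))"
      using not_integrable_integral_eq by fastforce
    then show ?thesis
      by (simp add: nn_integral_distr nn_integral_eq_integral eq[simplified])
  qed
  then show ?thesis
    by (subst nn_integral_potential_measure[OF S], simp)
      (subst nn_integral_exp_Ici[OF \<phi>, symmetric], auto intro!: nn_integral_cong split: split_indicator)
qed

section \<open>Growth of the Laplace exponent, mass at zero and the Green function\<close>

text \<open>Scaling from the base point \<open>1\<close> bounds \<open>\<phi> x\<close> below by a
  multiple of \<open>x powr \<gamma>\<close>. This serves to rule out mass of the potential measure
  at \<open>0\<close>.\<close>

lemma lower_scaling_at_top:
  assumes "lower_scaling \<phi> \<gamma> 0 CL"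
  shows "filterlim \<phi> at_top at_top"
proof (rule filterlim_at_top_mono)
  have \<phi>: "0 < \<phi> 1" "0 < CL" "0 < \<gamma>" "\<And>r x. 0 < r \<Longrightarrow> 1 \<le> x \<Longrightarrow> CL * x powr \<gamma> \<le> \<phi> (r * x) / \<phi> r"
    using assms by (auto simp: lower_scaling_def)
  show "filterlim (\<lambda>x. \<phi> 1 * CL * exp (\<gamma> * ln x)) at_top at_top"
    using \<phi> by (intro filterlim_tendsto_pos_mult_at_top[OF tendsto_const]
      filterlim_compose[OF exp_at_top] ln_at_top) auto
  show "\<forall>\<^sub>F x in at_top. \<phi> 1 * CL * exp (\<gamma> * ln x) \<le> \<phi> x"
    using eventually_ge_at_top[of 1]
    by eventually_elim (use \<phi>(1) \<phi>(4)[of 1] in \<open>auto simp: field_simps powr_def\<close>)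
qed

text \<open>On \<open>{..0}\<close> the function \<open>exp (- r * s)\<close> is at least
  \<open>1\<close>, so the mass there is at most \<open>1 / \<phi> r\<close> for every
  \<open>r > 0\<close>, and this tends to \<open>0\<close>.\<close>

lemma potential_measure_AE_pos:
  assumes "subordinator M S" and "laplace_exponent M S \<phi>" and "\<And>r. 0 < r \<Longrightarrow> 0 < \<phi> r"
    and "filterlim \<phi> at_top at_top"
  shows "AE s in potential_measure M S. 0 < s"
proof (rule AE_I)
  let ?U = "potential_measure M S"
  have le: "emeasure ?U {..0} \<le> ennreal (1 / \<phi> r)" if r: "0 < r" for r
  proof -
    have "emeasure ?U {..0} = (\<integral>\<^sup>+ s. indicator {..0} s \<partial>?U)" by simp
    also have "\<dots> \<le> (\<integral>\<^sup>+ s. ennreal (exp (- r * s)) \<partial>?U)"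
      using r by (intro nn_integral_mono)
        (auto split: split_indicator simp: mult_nonneg_nonpos simp flip: ennreal_1 intro!: ennreal_leI)
    finally show ?thesis
      using laplace_potential_measure[OF assms(1,2) r assms(3)[OF r]] by simp
  qed
  have "((\<lambda>r. ennreal (1 / \<phi> r)) \<longlongrightarrow> ennreal 0) at_top"
    using assms(4) by (intro tendsto_ennrealI tendsto_divide_0[OF tendsto_const] filterlim_at_top_imp_at_infinity)
  then have "emeasure ?U {..0} \<le> ennreal 0"
    by (rule tendsto_lowerbound)
      (auto intro: eventually_mono[OF eventually_gt_at_top[of 0]] le)
  then show "emeasure ?U {..0} = 0" by simp
qed auto

text \<open>\<open>transition_density\<close> integrates over \<open>{0<..}\<close> only; almost
  everywhere positivity lets this restriction be dropped.\<close>

lemma green_function_potential_measure: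
  assumes S: "subordinator M S" and pos: "AE s in potential_measure M S. 0 < s"
  shows "green_function M S (x :: 'a::euclidean_space) = (\<integral>\<^sup>+ s. ennreal ((4 * pi * s) powr (- (real DIM('a) / 2))
    * exp (- (norm x)\<^sup>2 / (4 * s))) \<partial>potential_measure M S)"
proof -
  have "green_function M S x = (\<integral>\<^sup>+ s. ennreal ((4 * pi * s) powr (- (real DIM('a) / 2))
      * exp (- (norm x)\<^sup>2 / (4 * s))) * indicator {0<..} s \<partial>potential_measure M S)"
    unfolding green_function_def transition_density_def
    by (rule nn_integral_potential_measure[OF S, symmetric]) measurable
  also have "\<dots> = (\<integral>\<^sup>+ s. ennreal ((4 * pi * s) powr (- (real DIM('a) / 2))
      * exp (- (norm x)\<^sup>2 / (4 * s))) \<partial>potential_measure M S)"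
    using pos by (intro nn_integral_cong_AE) auto
  finally show ?thesis .
qed

text \<open>A Bernstein function is concave and vanishes at \<open>0\<close>, so it has the upper scaling property with
  exponent \<open>1\<close>. Integrability of the integrand comes from \<open>\<phi> > 0\<close>.\<close>

lemma levy_khintchine_upper_scaling:
  assumes LK: "levy_khintchine \<phi> 0 \<mu>" and pos: "\<And>r. 0 < r \<Longrightarrow> 0 < \<phi> r"
  shows "upper_scaling \<phi> 1 0 1"
proof -
  have eq: "\<phi> r = (LINT s|\<mu>. 1 - exp (- r * s))" if "0 < r" for r
    using LK that by (auto simp: levy_khintchine_def)
  have int: "integrable \<mu> (\<lambda>s. 1 - exp (- r * s))" if "0 < r" for r
    using eq[OF that] pos[OF that] not_integrable_integral_eq by fastforce
  have space: "space \<mu> = {0<..}"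
    using LK sets_eq_imp_space_eq[of \<mu> "restrict_space borel {0<..}"]
    by (auto simp: levy_khintchine_def levy_measure_def space_restrict_space)
  have "\<phi> (r * x) \<le> x * \<phi> r" if r: "0 < r" and x: "1 \<le> x" for r x
  proof -
    have "0 < r * x" using r x by auto
    have "1 - exp (- (r * x) * s) \<le> x * (1 - exp (- r * s))" for s :: real
    proof -
      \<comment> \<open>The point \<open>- r * s\<close> is the fraction \<open>1 / x\<close> of the
        way from \<open>0\<close> to \<open>- (r * x) * s\<close>, so convexity puts
        \<open>exp (- r * s)\<close> below the chord.\<close>
      have "exp ((1 - 1 / x) *\<^sub>R 0 + (1 / x) *\<^sub>R (- (r * x) * s))
          \<le> (1 - 1 / x) * exp 0 + (1 / x) * exp (- (r * x) * s)"
        using x by (intro convex_onD[OF exp_convex]) auto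
      then have "x * exp (- (1 / x) * ((r * x) * s)) \<le> x * ((1 - 1 / x) + (1 / x) * exp (- (r * x) * s))"
        using x by (intro mult_left_mono) auto
      then show ?thesis using x by (simp add: algebra_simps)
    qed
    then have "(LINT s|\<mu>. 1 - exp (- (r * x) * s)) \<le> (LINT s|\<mu>. x * (1 - exp (- r * s)))"
      using int[OF \<open>0 < r * x\<close>] int[OF r] by (intro integral_mono) auto
    then show ?thesis using eq[OF r] eq[OF \<open>0 < r * x\<close>] by simp
  qed
  then show ?thesis using pos by (auto simp: upper_scaling_def field_simps)
qed


section \<open>Pointwise comparison of the Gaussian kernel with exponentials\<close>

text \<open>The \<open>h\<close>-th power of \<open>y \<le> exp y\<close> at
  \<open>y = v / (4 * h)\<close>. The rate \<open>1 / 4\<close> is that of the Gaussian factor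
  \<open>exp (- 1 / (4 * u))\<close> with \<open>v = 1 / u\<close>.\<close>

lemma powr_le_exp_quarter:
  assumes "0 < h" "0 < (v::real)"
  shows "v powr h \<le> (4 * h) powr h * exp (v / 4)"
proof -
  have "v / (4 * h) \<le> exp (v / (4 * h))"
    using exp_ge_add_one_self[of "v / (4 * h)"] by linarith
  then have "(v / (4 * h)) powr h \<le> exp (v / (4 * h)) powr h"
    using assms by (intro powr_mono2) auto
  also have "\<dots> = exp (v / 4)"
    using assms by (simp add: powr_def)
  finally show ?thesis
    using assms by (simp add: powr_divide divide_le_eq mult.commute)
qed

text \<open>A single dyadic scale suffices for each \<open>u\<close>: \<open>k = 0\<close> if
  \<open>u \<le> 1\<close>, where the Gaussian factor absorbs the singularity of
  \<open>u powr (- h)\<close>, and otherwise a \<open>k\<close> with \<open>2 ^ k\<close> between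
  \<open>u\<close> and \<open>2 * u\<close>.\<close>

lemma gaussian_kernel_le_dyadic_exp:
  assumes "0 < (h::real)"
  obtains C where "0 < C"
    "\<And>u. 0 < u \<Longrightarrow> \<exists>k::nat. u powr (- h) * exp (- 1 / (4 * u)) \<le> C * (2 powr (- h)) ^ k * exp (- u / 2 ^ k)"
proof
  \<comment> \<open>The two summands serve \<open>u \<le> 1\<close> and \<open>u > 1\<close>;
    \<open>exp 1\<close> pays for the factor \<open>exp (- u / 2 ^ k)\<close>, which is at least
    \<open>exp (- 1)\<close> since \<open>u \<le> 2 ^ k\<close>.\<close>
  let ?C = "exp 1 * ((4 * h) powr h + 2 powr h)"
  show "0 < ?C" by (intro mult_pos_pos add_nonneg_pos) auto
  fix u :: real assume u: "0 < u"
  show "\<exists>k::nat. u powr (- h) * exp (- 1 / (4 * u)) \<le> ?C * (2 powr (- h)) ^ k * exp (- u / 2 ^ k)"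
  proof (cases "u \<le> 1")
    case True
    have "u powr (- h) * exp (- 1 / (4 * u)) = (1 / u) powr h * exp (- ((1 / u) / 4))"
      using u by (simp add: powr_minus powr_divide field_simps)
    also have "\<dots> \<le> ((4 * h) powr h * exp ((1 / u) / 4)) * exp (- ((1 / u) / 4))"
      using powr_le_exp_quarter[of h "1 / u"] assms u by (intro mult_right_mono) auto
    also have "\<dots> = (4 * h) powr h"
      by (simp add: exp_minus)
    also have "\<dots> \<le> ((4 * h) powr h + 2 powr h) * 1"
      by simp
    also have "\<dots> \<le> ((4 * h) powr h + 2 powr h) * exp (1 - u)"
      using True by (intro mult_left_mono) auto
    also have "\<dots> = ?C * (2 powr (- h)) ^ 0 * exp (- u / 2 ^ 0)"
      using exp_add[of 1 "- u"] by simp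
    finally show ?thesis by blast
  next
    case False
    define k where "k = nat \<lceil>log 2 u\<rceil>"
    have "0 < log 2 u" using False by simp
    then have k: "log 2 u \<le> real k" "real k - 1 \<le> log 2 u"
      unfolding k_def by linarith+
    have "u \<le> 2 powr real k" "2 powr (real k - 1) \<le> u"
      using k u by (simp_all add: log_le_iff le_log_iff)
    then have "u / 2 ^ k \<le> 1" by (simp add: powr_realpow)
    have "u powr (- h) * exp (- 1 / (4 * u)) \<le> u powr (- h)"
      using u by (simp add: mult_left_le)
    also have "\<dots> \<le> (2 powr (real k - 1)) powr (- h)"
      using \<open>2 powr (real k - 1) \<le> u\<close> assms by (intro powr_mono2') auto
    also have "\<dots> = 2 powr h * (2 powr (- h)) ^ k"
      by (simp add: powr_powr powr_realpow[symmetric] powr_add[symmetric] algebra_simps)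
    also have "\<dots> \<le> ((4 * h) powr h + 2 powr h) * (2 powr (- h)) ^ k"
      by (intro mult_right_mono) auto
    also have "\<dots> \<le> ((4 * h) powr h + 2 powr h) * (2 powr (- h)) ^ k * exp (1 - u / 2 ^ k)"
      using \<open>u / 2 ^ k \<le> 1\<close>
        mult_left_mono[of 1 "exp (1 - u / 2 ^ k)" "((4 * h) powr h + 2 powr h) * (2 powr (- h)) ^ k"]
      by simp
    also have "\<dots> = ?C * (2 powr (- h)) ^ k * exp (- u / 2 ^ k)"
      using exp_add[of 1 "- u / 2 ^ k"] by simp
    finally show ?thesis by blast
  qed
qed

text \<open>Each summand alone dominates on one range. Between \<open>a\<close> and \<open>b\<close>
  the profile is at least \<open>b powr (- h) * exp (- 1 / (4 * a))\<close>; below \<open>a\<close>,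
  \<open>u / a \<le> 1\<close>; above \<open>b\<close>, half of the exponent is traded for
  \<open>- b / 2\<close>.\<close>

lemma exp_le_gaussian_kernel:
  assumes "0 < a" "0 < b" "0 < h" "0 < (u::real)"
  shows "exp (- u) \<le> b powr h * exp (1 / (4 * a)) * (u powr (- h) * exp (- 1 / (4 * u)))
    + exp 1 * exp (- u / a) + exp (- b / 2) * exp (- u / 2)"
proof -
  consider "u < a" | "a \<le> u" "u \<le> b" | "b < u" by linarith
  then have "exp (- u) \<le> exp 1 * exp (- u / a) \<or> exp (- u) \<le> exp (- b / 2) * exp (- u / 2)
    \<or> exp (- u) \<le> b powr h * exp (1 / (4 * a)) * (u powr (- h) * exp (- 1 / (4 * u)))"
  proof cases
    case 1
    then have "u / a \<le> 1" using assms by simp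
    then have "- u \<le> 1 + - u / a" using assms by linarith
    then show ?thesis by (simp flip: exp_add)
  next
    case 2
    have "b powr h * u powr (- h) = (b / u) powr h"
      using assms by (simp add: powr_divide powr_minus field_simps)
    moreover have "1 \<le> (b / u) powr h"
      using 2 assms by (intro ge_one_powr_ge_zero) auto
    moreover have "1 \<le> exp (1 / (4 * a) + - 1 / (4 * u))"
      using 2 assms by (simp add: field_simps)
    ultimately have "1 * 1 \<le> (b powr h * u powr (- h)) * exp (1 / (4 * a) + - 1 / (4 * u))"
      by (intro mult_mono) auto
    moreover have "exp (- u) \<le> 1 * 1" using assms by simp
    ultimately have "exp (- u) \<le> (b powr h * u powr (- h)) * (exp (1 / (4 * a)) * exp (- 1 / (4 * u)))"
      unfolding exp_add by linarith
    then show ?thesis by (simp only: mult_ac simp_thms)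
  next
    case 3
    then show ?thesis by (simp flip: exp_add)
  qed
  moreover have "0 \<le> exp 1 * exp (- u / a)" "0 \<le> exp (- b / 2) * exp (- u / 2)"
    "0 \<le> b powr h * exp (1 / (4 * a)) * (u powr (- h) * exp (- 1 / (4 * u)))" by simp_all
  ultimately show ?thesis by linarith
qed

text \<open>The substitution \<open>s = R * u\<close> isolates the dependence on \<open>R\<close> in
  one prefactor.\<close>

lemma gaussian_kernel_rescale:
  assumes "0 < R" "0 < (s::real)"
  shows "(4 * pi * s) powr (- h) * exp (- R / (4 * s))
    = (4 * pi * R) powr (- h) * ((s / R) powr (- h) * exp (- 1 / (4 * (s / R))))"
proof -
  have s: "(4 * pi * R) * (s / R) = 4 * pi * s" using assms by simp
  have e: "- R / (4 * s) = - 1 / (4 * (s / R))" using assms by (simp add: divide_simps)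
  show ?thesis unfolding e mult.assoc[symmetric] powr_mult[symmetric] by (simp only: s)
qed

section \<open>Upper and lower bounds for the Gaussian potential integral\<close>

text \<open>After integration the \<open>k\<close>-th exponential costs
  \<open>1 / \<phi> (1 / (R * 2 ^ k))\<close>. Upper scaling bounds this by
  \<open>1 / \<phi> (1 / R)\<close> times \<open>CU * 2 powr (k * \<delta>)\<close>, and the series
  becomes geometric.\<close>

lemma gaussian_potential_upper:
  assumes [measurable_cong]: "sets U = sets borel" and pos: "AE s in U. (0::real) < s"
    and laplace: "\<And>r. 0 < r \<Longrightarrow> (\<integral>\<^sup>+ s. ennreal (exp (- r * s)) \<partial>U) = ennreal (1 / \<phi> r)"
    and scaling: "upper_scaling \<phi> \<delta> 0 CU" and "\<delta> < h"
  obtains c where "0 < c" "\<And>R. 0 < R \<Longrightarrow>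
    (\<integral>\<^sup>+ s. ennreal ((4 * pi * s) powr (- h) * exp (- R / (4 * s))) \<partial>U) \<le> ennreal (c / (R powr h * \<phi> (1 / R)))"
proof -
  have laplace': "(\<integral>\<^sup>+ s. ennreal (exp (- (s / c))) \<partial>U) = ennreal (1 / \<phi> (1 / c))" if "0 < c" for c
    using laplace[of "1 / c"] that by simp
  have \<phi>: "\<And>r. 0 < r \<Longrightarrow> 0 < \<phi> r" "0 < CU" "0 < \<delta>"
    "\<And>r x. 0 < r \<Longrightarrow> 1 \<le> x \<Longrightarrow> \<phi> (r * x) / \<phi> r \<le> CU * x powr \<delta>"
    using scaling by (auto simp: upper_scaling_def)
  then have "0 < h" using \<open>\<delta> < h\<close> by linarith
  then obtain C where C: "0 < C" "\<And>u. 0 < u \<Longrightarrow>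
      \<exists>k::nat. u powr (- h) * exp (- 1 / (4 * u)) \<le> C * (2 powr (- h)) ^ k * exp (- u / 2 ^ k)"
    using gaussian_kernel_le_dyadic_exp by blast
  \<comment> \<open>Ratio of successive scales: \<open>2 powr (- h)\<close> from the kernel times
    \<open>2 powr \<delta>\<close> from the scaling; it is below \<open>1\<close> because
    \<open>\<delta> < h\<close>.\<close>
  define q where "q = 2 powr (\<delta> - h)"
  have q: "0 < q" "q < 1"
    using \<open>\<delta> < h\<close> powr_less_mono[of "\<delta> - h" 0 2] by (auto simp: q_def)
  let ?c = "(4 * pi) powr (- h) * C * CU / (1 - q)"
  show thesis
  proof
    show "0 < ?c" using C \<phi> q by simp
    fix R :: real assume R: "0 < R"
    define D where "D = (4 * pi * R) powr (- h) * C"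
    have D: "0 < D" using R C by (simp add: D_def)
    have "(\<integral>\<^sup>+ s. ennreal ((4 * pi * s) powr (- h) * exp (- R / (4 * s))) \<partial>U)
      \<le> (\<integral>\<^sup>+ s. (\<Sum>k. ennreal (D * (2 powr (- h)) ^ k) * ennreal (exp (- (1 / (R * 2 ^ k)) * s))) \<partial>U)"
    proof (rule nn_integral_mono_AE)
      show "AE s in U. ennreal ((4 * pi * s) powr (- h) * exp (- R / (4 * s)))
        \<le> (\<Sum>k. ennreal (D * (2 powr (- h)) ^ k) * ennreal (exp (- (1 / (R * 2 ^ k)) * s)))"
        using pos
      proof eventually_elim
        case (elim s)
        then obtain k :: nat where "(s / R) powr (- h) * exp (- 1 / (4 * (s / R)))
            \<le> C * (2 powr (- h)) ^ k * exp (- (s / R) / 2 ^ k)"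
          using C(2)[of "s / R"] R by auto
        then have "(4 * pi * s) powr (- h) * exp (- R / (4 * s))
            \<le> (4 * pi * R) powr (- h) * (C * (2 powr (- h)) ^ k * exp (- (s / R) / 2 ^ k))"
          unfolding gaussian_kernel_rescale[OF R elim] by (intro mult_left_mono) auto
        also have "\<dots> = D * (2 powr (- h)) ^ k * exp (- (1 / (R * 2 ^ k)) * s)"
          by (simp add: D_def)
        finally have "ennreal ((4 * pi * s) powr (- h) * exp (- R / (4 * s)))
            \<le> ennreal (D * (2 powr (- h)) ^ k) * ennreal (exp (- (1 / (R * 2 ^ k)) * s))"
          using D by (simp add: ennreal_leI flip: ennreal_mult)
        \<comment> \<open>The suitable \<open>k\<close> varies with \<open>s\<close>; summing over
          all \<open>k\<close> gives one bound valid for every \<open>s\<close>, which can be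
          integrated termwise.\<close>
        also have "\<dots> \<le> (\<Sum>k. ennreal (D * (2 powr (- h)) ^ k) * ennreal (exp (- (1 / (R * 2 ^ k)) * s)))"
          using sum_le_suminf[of
            "\<lambda>k. ennreal (D * (2 powr (- h)) ^ k) * ennreal (exp (- (1 / (R * 2 ^ k)) * s))" "{k}"]
          by simp
        finally show ?case .
      qed
    qed
    also have "\<dots> = (\<Sum>k. ennreal (D * (2 powr (- h)) ^ k) * ennreal (1 / \<phi> (1 / (R * 2 ^ k))))"
      using R by (subst nn_integral_suminf) (simp_all add: nn_integral_cmult laplace')
    also have "\<dots> \<le> (\<Sum>k. ennreal (D * CU / \<phi> (1 / R) * q ^ k))"
    proof (intro suminf_le allI)
      fix k :: nat
      have "0 < \<phi> (1 / (R * 2 ^ k))" "0 < \<phi> (1 / R)" using \<phi> R by auto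
      moreover have "\<phi> (1 / R) / \<phi> (1 / (R * 2 ^ k)) \<le> CU * (2 ^ k) powr \<delta>"
        using \<phi>(4)[of "1 / (R * 2 ^ k)" "2 ^ k"] R by simp
      ultimately have "1 / \<phi> (1 / (R * 2 ^ k)) \<le> CU * (2 ^ k) powr \<delta> / \<phi> (1 / R)"
        by (simp add: field_simps)
      then have "D * (2 powr (- h)) ^ k * (1 / \<phi> (1 / (R * 2 ^ k)))
          \<le> D * (2 powr (- h)) ^ k * (CU * (2 ^ k) powr \<delta> / \<phi> (1 / R))"
        using D by (intro mult_left_mono) auto
      also have "\<dots> = D * CU / \<phi> (1 / R) * ((2 powr (- h)) ^ k * (2 ^ k) powr \<delta>)"
        by simp
      also have "(2 powr (- h)) ^ k * (2 ^ k) powr \<delta> = q ^ k"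
      proof -
        have "(2 ^ k) powr \<delta> = (2 powr \<delta>) ^ k"
          using powr_powr_swap[of 2 "real k" \<delta>] by (simp only: powr_realpow zero_less_numeral powr_gt_zero)
        then show ?thesis
          using powr_add[of 2 \<delta> "- h"] by (simp add: q_def power_mult_distrib mult.commute)
      qed
      finally show "ennreal (D * (2 powr (- h)) ^ k) * ennreal (1 / \<phi> (1 / (R * 2 ^ k)))
          \<le> ennreal (D * CU / \<phi> (1 / R) * q ^ k)"
        using D \<open>0 < \<phi> (1 / (R * 2 ^ k))\<close> by (simp add: ennreal_leI flip: ennreal_mult)
    qed auto
    also have "\<dots> = ennreal (\<Sum>k. D * CU / \<phi> (1 / R) * q ^ k)"
      using D \<phi>(2) \<phi>(1)[of "1 / R"] R q
      by (intro suminf_ennreal2 summable_mult summable_geometric) (simp_all add: less_imp_le)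
    also have "(\<Sum>k. D * CU / \<phi> (1 / R) * q ^ k) = D * CU / \<phi> (1 / R) * (1 / (1 - q))"
      using q by (subst suminf_mult) (auto simp: suminf_geometric intro: summable_geometric)
    also have "\<dots> = ?c / (R powr h * \<phi> (1 / R))"
      using R by (simp add: D_def powr_mult powr_minus field_simps)
    finally show "(\<integral>\<^sup>+ s. ennreal ((4 * pi * s) powr (- h) * exp (- R / (4 * s))) \<partial>U)
        \<le> ennreal (?c / (R powr h * \<phi> (1 / R)))" .
  qed
qed

text \<open>Integrating the bound of \<open>exp_le_gaussian_kernel\<close> gives
  \<open>P \<le> A * R powr h * I + P / 2\<close> with \<open>P = 1 / \<phi> (1 / R)\<close> and
  \<open>I\<close> the Gaussian integral; half of \<open>P\<close> is then absorbed on the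
  left.\<close>

lemma gaussian_potential_lower:
  assumes [measurable_cong]: "sets U = sets borel" and pos: "AE s in U. (0::real) < s"
    and laplace: "\<And>r. 0 < r \<Longrightarrow> (\<integral>\<^sup>+ s. ennreal (exp (- r * s)) \<partial>U) = ennreal (1 / \<phi> r)"
    and lower: "lower_scaling \<phi> \<gamma> 0 CL" and upper: "upper_scaling \<phi> \<delta> 0 CU" and "0 < h"
  obtains c where "0 < c" "\<And>R. 0 < R \<Longrightarrow>
    ennreal (1 / (R powr h * \<phi> (1 / R)))
      \<le> ennreal c * (\<integral>\<^sup>+ s. ennreal ((4 * pi * s) powr (- h) * exp (- R / (4 * s))) \<partial>U)"
proof -
  have laplace': "(\<integral>\<^sup>+ s. ennreal (exp (- (s / c))) \<partial>U) = ennreal (1 / \<phi> (1 / c))" if "0 < c" for c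
    using laplace[of "1 / c"] that by simp
  have \<phi>: "\<And>r. 0 < r \<Longrightarrow> 0 < \<phi> r" "0 < CU" "0 < CL" "0 < \<gamma>"
    "\<And>r x. 0 < r \<Longrightarrow> 1 \<le> x \<Longrightarrow> \<phi> (r * x) / \<phi> r \<le> CU * x powr \<delta>"
    "\<And>r x. 0 < r \<Longrightarrow> 1 \<le> x \<Longrightarrow> CL * x powr \<gamma> \<le> \<phi> (r * x) / \<phi> r"
    using upper lower by (auto simp: upper_scaling_def lower_scaling_def)
  \<comment> \<open>The second entry solves \<open>exp 1 * a powr \<gamma> = CL / 4\<close>; the cap
    at \<open>1\<close> makes \<open>1 / a\<close> an admissible factor in lower scaling.\<close>
  define a where "a = min 1 ((CL / (4 * exp 1)) powr (1 / \<gamma>))"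
  have a: "0 < a" "a \<le> 1" using \<phi> by (auto simp: a_def)
  have "a powr \<gamma> \<le> ((CL / (4 * exp 1)) powr (1 / \<gamma>)) powr \<gamma>"
    using \<phi> a by (intro powr_mono2) (auto simp: a_def)
  also have "\<dots> = CL / (4 * exp 1)" using \<phi> by (simp add: powr_powr)
  finally have a': "exp 1 * a powr \<gamma> \<le> CL / 4" by (simp add: field_simps)
  \<comment> \<open>The logarithm is the value at which
    \<open>exp (- b / 2) * CU * 2 powr \<delta>\<close> equals \<open>1 / 4\<close>; the
    \<open>1\<close> keeps \<open>b\<close> positive.\<close>
  define b where "b = max 1 (2 * ln (4 * CU * 2 powr \<delta>))"
  have "exp (- b / 2) \<le> exp (- ln (4 * CU * 2 powr \<delta>))" by (simp add: b_def)
  also have "\<dots> = 1 / (4 * CU * 2 powr \<delta>)" using \<phi> by (simp add: exp_minus inverse_eq_divide)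
  finally have b': "exp (- b / 2) * (CU * 2 powr \<delta>) \<le> 1 / 4" using \<phi> by (simp add: field_simps)
  have b: "0 < b" by (simp add: b_def)
  \<comment> \<open>The factor \<open>(4 * pi) powr h\<close> undoes the normalization that
    \<open>gaussian_kernel_rescale\<close> pulls out.\<close>
  define A where "A = (4 * pi) powr h * (b powr h * exp (1 / (4 * a)))"
  have A: "0 < A" using b by (simp add: A_def)
  show thesis
  proof
    show "0 < 2 * A" using A by simp
    fix R :: real assume R: "0 < R"
    let ?I = "\<integral>\<^sup>+ s. ennreal ((4 * pi * s) powr (- h) * exp (- R / (4 * s))) \<partial>U"
    define P where "P = 1 / \<phi> (1 / R)"
    have P: "0 < P" using \<phi> R by (simp add: P_def)
    have p: "0 < \<phi> (1 / R)" "0 < \<phi> (1 / (R * a))" "0 < \<phi> (1 / (2 * R))" using \<phi> R a by auto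
    \<comment> \<open>Lower scaling from \<open>1 / R\<close> up by the factor
      \<open>1 / a\<close>.\<close>
    have le1: "exp 1 * (1 / \<phi> (1 / (R * a))) \<le> P / 4"
    proof -
      have "CL * (1 / a) powr \<gamma> \<le> \<phi> (1 / (R * a)) / \<phi> (1 / R)"
        using \<phi>(6)[of "1 / R" "1 / a"] R a by simp
      then have "CL * \<phi> (1 / R) \<le> a powr \<gamma> * \<phi> (1 / (R * a))"
        using a p by (simp add: powr_divide field_simps)
      then have "exp 1 * (CL * \<phi> (1 / R)) \<le> (exp 1 * a powr \<gamma>) * \<phi> (1 / (R * a))"
        by (simp add: mult.assoc)
      also have "\<dots> \<le> CL / 4 * \<phi> (1 / (R * a))"
        using a' p by (intro mult_right_mono) auto
      finally have "CL * (4 * (exp 1 * \<phi> (1 / R))) \<le> CL * \<phi> (1 / (R * a))"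
        by (simp add: algebra_simps)
      then have "4 * (exp 1 * \<phi> (1 / R)) \<le> \<phi> (1 / (R * a))"
        using \<phi> by simp
      then show ?thesis using p by (simp add: P_def field_simps)
    qed
    \<comment> \<open>Upper scaling from \<open>1 / (2 * R)\<close> up by the factor
      \<open>2\<close>.\<close>
    have le2: "exp (- b / 2) * (1 / \<phi> (1 / (2 * R))) \<le> P / 4"
    proof -
      have "\<phi> (1 / R) / \<phi> (1 / (2 * R)) \<le> CU * 2 powr \<delta>"
        using \<phi>(5)[of "1 / (2 * R)" 2] R by simp
      then have "exp (- b / 2) * (\<phi> (1 / R) / \<phi> (1 / (2 * R))) \<le> exp (- b / 2) * (CU * 2 powr \<delta>)"
        by (intro mult_left_mono) auto
      also note b'
      finally show ?thesis using p by (simp add: P_def field_simps)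
    qed
    have "ennreal P = (\<integral>\<^sup>+ s. ennreal (exp (- (1 / R) * s)) \<partial>U)"
      using R by (simp add: laplace' P_def)
    also have "\<dots> \<le> (\<integral>\<^sup>+ s. ennreal (A * R powr h) * ennreal ((4 * pi * s) powr (- h) * exp (- R / (4 * s)))
        + (ennreal (exp 1) * ennreal (exp (- (1 / (R * a)) * s))
          + ennreal (exp (- b / 2)) * ennreal (exp (- (1 / (2 * R)) * s))) \<partial>U)"
    proof (rule nn_integral_mono_AE)
      show "AE s in U. ennreal (exp (- (1 / R) * s))
        \<le> ennreal (A * R powr h) * ennreal ((4 * pi * s) powr (- h) * exp (- R / (4 * s)))
          + (ennreal (exp 1) * ennreal (exp (- (1 / (R * a)) * s))
            + ennreal (exp (- b / 2)) * ennreal (exp (- (1 / (2 * R)) * s)))"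
        using pos
      proof eventually_elim
        case (elim s)
        have "b powr h * exp (1 / (4 * a)) = A * R powr h * (4 * pi * R) powr (- h)"
          using R by (simp add: A_def powr_mult powr_minus field_simps)
        then have "exp (- (1 / R) * s) \<le> A * R powr h * ((4 * pi * s) powr (- h) * exp (- R / (4 * s)))
          + (exp 1 * exp (- (1 / (R * a)) * s) + exp (- b / 2) * exp (- (1 / (2 * R)) * s))"
          using exp_le_gaussian_kernel[OF a(1) b \<open>0 < h\<close>, of "s / R"] R elim
          unfolding gaussian_kernel_rescale[OF R elim] by (simp add: mult.assoc mult.commute[of 2 R])
        from ennreal_leI[OF this] show ?case
          using A by (simp add: ennreal_plus ennreal_mult)
      qed
    qed
    also have "\<dots> = ennreal (A * R powr h) * ?I
        + (ennreal (exp 1) * ennreal (1 / \<phi> (1 / (R * a)))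
          + ennreal (exp (- b / 2)) * ennreal (1 / \<phi> (1 / (2 * R))))"
      using R a by (simp add: nn_integral_add nn_integral_cmult laplace')
    also have "\<dots> \<le> ennreal (A * R powr h) * ?I + (ennreal (P / 4) + ennreal (P / 4))"
      using p le1 le2 by (intro add_mono order.refl) (simp_all add: ennreal_leI flip: ennreal_mult)
    also have "ennreal (P / 4) + ennreal (P / 4) = ennreal (P / 2)"
      using P by (simp flip: ennreal_plus)
    finally have main: "ennreal P \<le> ennreal (A * R powr h) * ?I + ennreal (P / 2)" .
    show "ennreal (1 / (R powr h * \<phi> (1 / R))) \<le> ennreal (2 * A) * ?I"
    \<comment> \<open>Subtracting \<open>P / 2\<close> is done in the reals; if the Gaussian
      integral is infinite, the bound is trivial.\<close>
    proof (cases ?I rule: ennreal_cases)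
      case (real I)
      then have "ennreal P \<le> ennreal (A * R powr h * I + P / 2)"
        using main A P by (simp add: ennreal_mult)
      then have "P \<le> A * R powr h * I + P / 2"
        using A P real by (subst (asm) ennreal_le_iff) auto
      then have "P \<le> 2 * A * I * R powr h"
        by (simp add: algebra_simps)
      then have "P / R powr h \<le> 2 * A * I"
        using R by (simp add: divide_le_eq)
      then have "1 / (R powr h * \<phi> (1 / R)) \<le> 2 * A * I"
        by (simp add: P_def mult.commute)
      then show ?thesis using real A by (simp add: ennreal_leI flip: ennreal_mult)
    next
      case top
      then show ?thesis using A by (simp add: ennreal_mult_top)
    qed
  qed
qed

section \<open>Two-sided estimate of the Green function\<close>

text \<open>Both potential bounds are taken at \<open>R = |x|^2\<close> and
  \<open>h = d / 2\<close>, where \<open>R powr h\<close> is \<open>|x|^d\<close>.\<close>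

lemma green_function_comparable:
  fixes M :: "'w measure" and S :: "real \<Rightarrow> 'w \<Rightarrow> real"
  assumes S: "subordinator M S" and L: "laplace_exponent M S \<phi>"
    and lower: "lower_scaling \<phi> \<gamma> 0 CL"
    and upper: "upper_scaling \<phi> \<delta> 0 CU" and \<delta>: "\<delta> < real DIM('a) / 2"
  shows "comparable_on {x :: 'a::euclidean_space. x \<noteq> 0} (green_function M S)
    (\<lambda>x. ennreal (1 / (norm x ^ DIM('a) * \<phi> (norm x powr (- 2)))))"
proof -
  let ?U = "potential_measure M S" and ?h = "real DIM('a) / 2"
  let ?g = "\<lambda>x::'a. norm x ^ DIM('a) * \<phi> (norm x powr (- 2))"
  have \<phi>: "0 < \<phi> r" if "0 < r" for r using lower that by (auto simp: lower_scaling_def)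
  have pos: "AE s in ?U. 0 < s"
    using S L \<phi> lower_scaling_at_top[OF lower] by (rule potential_measure_AE_pos)
  note laplace = laplace_potential_measure[OF S L _ \<phi>]
  obtain c1 where c1: "0 < c1" "\<And>R. 0 < R \<Longrightarrow>
      (\<integral>\<^sup>+ s. ennreal ((4 * pi * s) powr (- ?h) * exp (- R / (4 * s))) \<partial>?U) \<le> ennreal (c1 / (R powr ?h * \<phi> (1 / R)))"
    using gaussian_potential_upper[OF sets_potential_measure pos laplace upper \<delta>] by blast
  obtain c2 where c2: "0 < c2" "\<And>R. 0 < R \<Longrightarrow> ennreal (1 / (R powr ?h * \<phi> (1 / R)))
      \<le> ennreal c2 * (\<integral>\<^sup>+ s. ennreal ((4 * pi * s) powr (- ?h) * exp (- R / (4 * s))) \<partial>?U)"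
    using gaussian_potential_lower[OF sets_potential_measure pos laplace lower upper, of ?h] by auto
  show ?thesis
    unfolding comparable_on_def
  proof (intro exI conjI ballI)
    \<comment> \<open>\<open>comparable_on\<close> attaches the constants to the Green function, so
      the upper bound enters through the inverse of \<open>c1\<close>.\<close>
    show "0 < 1 / c1" "0 < c2" using c1 c2 by auto
    fix x :: 'a assume "x \<in> {x. x \<noteq> 0}"
    then have x: "0 < norm x" by simp
    have eq: "((norm x)\<^sup>2) powr ?h * \<phi> (1 / (norm x)\<^sup>2) = ?g x"
    proof -
      have "norm x powr (- 2) = 1 / (norm x)\<^sup>2"
        using x by (simp add: powr_minus_divide)
      moreover have "((norm x)\<^sup>2) powr ?h = norm x ^ DIM('a)"
        using x powr_powr[of "norm x" 2 ?h] powr_realpow[of "norm x" "DIM('a)"] by simp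
      ultimately show ?thesis by simp
    qed
    note green = green_function_potential_measure[OF S pos, of x]
    have "ennreal (1 / c1) * green_function M S x \<le> ennreal (1 / c1) * ennreal (c1 / ?g x)"
      using c1(2)[of "(norm x)\<^sup>2"] x unfolding eq green by (intro mult_left_mono) auto
    also have "\<dots> = ennreal (1 / ?g x)"
      using c1(1) x \<phi>[of "norm x powr - 2"] by (simp flip: ennreal_mult)
    finally show "ennreal (1 / c1) * green_function M S x \<le> ennreal (1 / ?g x)" .
    show "ennreal (1 / ?g x) \<le> ennreal c2 * green_function M S x"
      using c2(2)[of "(norm x)\<^sup>2"] x unfolding eq green by simp
  qed
qed

theorem corollary1p8:
  fixes M :: "'w measure"
    and S :: "real \<Rightarrow> 'w \<Rightarrow> real"
    and B :: "real \<Rightarrow> 'w \<Rightarrow> 'a::euclidean_space"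
    and \<phi> :: "real \<Rightarrow> real"
    and \<mu> :: "real measure"
  assumes "subordinator M S"
    and "laplace_exponent M S \<phi>"
    and "levy_khintchine \<phi> 0 \<mu>"
    and "\<exists>\<gamma> CL. lower_scaling \<phi> \<gamma> 0 CL"
    and "brownian_motion M B"
    and "independent_processes M B S"
    and "transient M (subordinate B S)"
    and "DIM('a) \<le> 2 \<longrightarrow> (\<exists>\<delta> CU. \<delta> < real DIM('a) / 2 \<and> upper_scaling \<phi> \<delta> 0 CU)"
  shows "comparable_on {x :: 'a. x \<noteq> 0} (green_function M S)
           (\<lambda>x. ennreal (1 / (norm x ^ DIM('a) * \<phi> (norm x powr (- 2)))))"
proof -
  obtain \<gamma> CL where lower: "lower_scaling \<phi> \<gamma> 0 CL" using assms(4) by blast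
  \<comment> \<open>In dimension at least \<open>3\<close> concavity of \<open>\<phi>\<close>
    provides \<open>\<delta> = 1 < d / 2\<close>; in lower dimensions such an exponent is
    assumed.\<close>
  then have "\<exists>\<delta> CU. \<delta> < real DIM('a) / 2 \<and> upper_scaling \<phi> \<delta> 0 CU"
    using assms(8) levy_khintchine_upper_scaling[OF assms(3)]
    by (cases "DIM('a) \<le> 2") (auto simp: lower_scaling_def intro!: exI[of _ "1 :: real"])
  then show ?thesis
    using green_function_comparable[OF assms(1,2) lower] by blast
qed

end
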